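(* Let $G$ be an $(n,d,\lambda)$-r.c. graph with vertex set $V$, whose edges are colored by colors $1,\dots,t$. For any two colors $r,b\in\{1,\dots,t\}$ and every set of vertices $E\subseteq V$, \[ \left| e_{r,b}(E) - \left(\frac{d}{n}\right)^2 |E|^3 \right| \leqslant 2\,\frac{\lambda d}{n}\,|E|^2 + \lambda^2 |E|, \] where $e_{r,b}(E)$ is the number of ordered triples $(u,v,w)\in E\times E\times E$ such that $uv$ and $vw$ are edges of $G$, $uv$ has color $r$ and $vw$ has color $b$.
   Context: A graph is an $(n,d,\lambda)$-graph if it is a $d$-regular graph on $n$ vertices such that every eigenvalue of its adjacency matrix other than the largest one has absolute value at most $\lambda$. Suppose a graph $G$ on $n$ vertices has its edges colored with $t$ colors, and for each color $i$ let $G_i$ be the graph on the vertex set of $G$ whose edges are the edges of $G$ of color $i$. Then $G$ is called an $(n,d,\lambda)$-r.c. (regularly colored) graph if $G_i$ is an $(n,d,\lambda)$-graph for each color $i\in\{1,\dots,t\}$. *)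

theory Defs
  imports "Jordan_Normal_Form.Char_Poly" "Graph_Theory.Pair_Digraph"
begin

text \<open>Graphs are finite and simple: \<^locale>\<open>pair_graph\<close> is the locale of finite, symmetric,
  loop-free digraphs without parallel arcs. An undirected edge \<open>uv\<close> is represented by the two
  arcs \<open>(u, v)\<close> and \<open>(v, u)\<close>.\<close>

definition adj_matrix :: "'a pair_pre_digraph \<Rightarrow> 'a list \<Rightarrow> real mat" where
  "adj_matrix G vs = mat (length vs) (length vs)
     (\<lambda>(i, j). if (vs ! i, vs ! j) \<in> parcs G then 1 else 0)"

text \<open>The real eigenvalues with their algebraic multiplicities. For a real symmetric matrix
  these are all the eigenvalues.\<close>

definition spectrum_mset :: "real mat \<Rightarrow> real multiset" where
  "spectrum_mset A = proots (char_poly A)"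

text \<open>One occurrence of the largest eigenvalue is removed, so that a largest eigenvalue of
  multiplicity at least two must itself be bounded by \<open>lam\<close>. The choice of
  the vertex enumeration \<open>vs\<close> is immaterial, as reordering the vertices conjugates the
  adjacency matrix by a permutation matrix.\<close>

definition ndl_graph :: "nat \<Rightarrow> nat \<Rightarrow> real \<Rightarrow> 'a pair_pre_digraph \<Rightarrow> bool" where
  "ndl_graph n d lam G \<longleftrightarrow>
     pair_graph G \<and>
     card (pverts G) = n \<and>
     (\<forall>v \<in> pverts G. out_degree (with_proj G) v = d) \<and>
     (\<exists>vs. distinct vs \<and> set vs = pverts G \<and>
        (let S = spectrum_mset (adj_matrix G vs)
         in \<forall>\<mu> \<in># S - {# Max (set_mset S) #}. \<bar>\<mu>\<bar> \<le> lam))"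

text \<open>A colouring is a function on two-element vertex sets, so both arcs of an edge receive
  the same colour.\<close>

definition color_class :: "'a pair_pre_digraph \<Rightarrow> ('a set \<Rightarrow> nat) \<Rightarrow> nat \<Rightarrow> 'a pair_pre_digraph" where
  "color_class G c i =
     \<lparr> pverts = pverts G, parcs = {(u, v). (u, v) \<in> parcs G \<and> c {u, v} = i} \<rparr>"

definition rc_graph ::
    "nat \<Rightarrow> nat \<Rightarrow> real \<Rightarrow> nat \<Rightarrow> 'a pair_pre_digraph \<Rightarrow> ('a set \<Rightarrow> nat) \<Rightarrow> bool" where
  "rc_graph n d lam t G c \<longleftrightarrow>
     pair_graph G \<and>
     card (pverts G) = n \<and>
     (\<forall>u v. (u, v) \<in> parcs G \<longrightarrow> c {u, v} \<in> {1..t}) \<and>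
     (\<forall>i \<in> {1..t}. ndl_graph n d lam (color_class G c i))"

definition e_col :: "'a pair_pre_digraph \<Rightarrow> ('a set \<Rightarrow> nat) \<Rightarrow> nat \<Rightarrow> nat \<Rightarrow> 'a set \<Rightarrow> nat" where
  "e_col G c r b E = card {(u, v, w). (u, v, w) \<in> E \<times> E \<times> E \<and>
     (u, v) \<in> parcs G \<and> (v, w) \<in> parcs G \<and> c {u, v} = r \<and> c {v, w} = b}"

end

theory Submission
  imports Defs "Jordan_Normal_Form.Schur_Decomposition" "HOL-Analysis.Convex"
begin

text \<open>Let \<open>a i v\<close> be the number of neighbours of \<open>v\<close> in \<open>E\<close> along colour \<open>i\<close>, and \<open>k = d |E| / n\<close>.
  Then \<open>e_col\<close> is the sum of \<open>a r v * a b v\<close> over \<open>v \<in> E\<close>; expanding around \<open>k\<close>, Cauchy--Schwarz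
  reduces the theorem to the fact that the squares \<open>(a i v - k)\<^sup>2\<close> sum to at most \<open>lam\<^sup>2 |E|\<close>. This is
  \<open>|A x| \<le> lam |x|\<close> for the adjacency matrix \<open>A\<close> and a vector \<open>x\<close> orthogonal to the constants.
  Instead of an orthonormal eigenbasis, the proof of this bound uses high powers of \<open>A\<close>: with
  \<open>N = 2 ^ m\<close>, Cauchy--Schwarz gives \<open>|A x| ^ (2 N) \<le> |x| ^ (2 N - 2) * |A ^ N x|\<^sup>2\<close>, and the
  Frobenius norm of \<open>A ^ N\<close> on the orthogonal complement of the constants gives
  \<open>|A ^ N x|\<^sup>2 \<le> (tr (A ^ (2 N)) - d ^ (2 N)) |x|\<^sup>2 \<le> n * lam ^ (2 N) * |x|\<^sup>2\<close>. The factor \<open>n\<close> disappears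
  as \<open>m\<close> tends to infinity.\<close>

section \<open>Traces of powers of symmetric matrices\<close>

lemma proots_prod_list_linear:
  "proots (\<Prod>a\<leftarrow>as. [:- a, 1:]) = mset (as :: 'a :: idom list)"
proof (induction as)
  case (Cons a as)
  have "(\<Prod>a\<leftarrow>as. [:- a, 1:]) \<noteq> 0" by (auto simp: prod_list_zero_iff)
  with Cons show ?case by (simp add: proots_mult del: mult_pCons_left)
qed simp

text \<open>For an eigenvector \<open>v\<close> of \<open>a\<close>, the Hermitian form of
  \<open>A\<close> at \<open>v\<close> equals \<open>a\<close> times the positive number
  \<open>R\<close>. Symmetry makes this form its own conjugate, so \<open>a\<close> is real.\<close>

lemma symmetric_char_poly_root_real:
  fixes A :: "real mat" and a :: complex
  assumes A: "A \<in> carrier_mat n n" and sym: "transpose_mat A = A"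
    and root: "poly (char_poly (map_mat complex_of_real A)) a = 0"
  shows "a \<in> \<real>"
proof -
  let ?B = "map_mat complex_of_real A"
  have B: "?B \<in> carrier_mat n n" using A by simp
  from root have "eigenvalue ?B a" using eigenvalue_root_char_poly[OF B] by simp
  then obtain v where v: "v \<in> carrier_vec n" "v \<noteq> 0\<^sub>v n" "?B *\<^sub>v v = a \<cdot>\<^sub>v v"
    using A unfolding eigenvalue_def eigenvector_def by auto
  have sym': "A $$ (i, j) = A $$ (j, i)" if "i < n" "j < n" for i j
    using sym that A by (metis carrier_matD index_transpose_mat(1))
  have ev: "(\<Sum>j<n. of_real (A $$ (i, j)) * v $ j) = a * v $ i" if "i < n" for i
  proof -
    have "(?B *\<^sub>v v) $ i = (a \<cdot>\<^sub>v v) $ i" using v by simp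
    then show ?thesis using that A v(1) by (simp add: scalar_prod_def lessThan_atLeast0)
  qed
  define S where "S = (\<Sum>i<n. \<Sum>j<n. cnj (v $ i) * (of_real (A $$ (i, j)) * v $ j))"
  define R where "R = (\<Sum>i<n. (cmod (v $ i))\<^sup>2)"
  have S: "S = a * of_real R"
  proof -
    have "S = (\<Sum>i<n. cnj (v $ i) * (a * v $ i))"
      unfolding S_def sum_distrib_left[symmetric] by (intro sum.cong refl) (simp add: ev)
    also have "\<dots> = (\<Sum>i<n. a * of_real ((cmod (v $ i))\<^sup>2))"
      by (intro sum.cong refl) (simp add: complex_norm_square mult_ac del: of_real_power)
    finally show ?thesis by (simp add: R_def sum_distrib_left)
  qed
  \<comment> \<open>Conjugation exchanges the roles of \<open>i\<close> and \<open>j\<close>;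
    symmetry of \<open>A\<close> and swapping the sums restore \<open>S\<close>.\<close>
  have "cnj S = (\<Sum>i<n. \<Sum>j<n. cnj (v $ j) * (of_real (A $$ (j, i)) * v $ i))"
    unfolding S_def cnj_sum by (intro sum.cong refl) (simp add: sym' mult_ac)
  also have "\<dots> = S" unfolding S_def by (rule sum.swap)
  finally have "cnj a * of_real R = a * of_real R" unfolding S by simp
  moreover have "R \<noteq> 0"
  proof
    assume "R = 0"
    then have "v $ i = 0" if "i < n" for i
      using that unfolding R_def by (subst (asm) sum_nonneg_eq_0_iff) auto
    with v show False by (auto intro: eq_vecI)
  qed
  ultimately show ?thesis by (simp add: complex_eq_iff complex_is_Real_iff)
qed

text \<open>Factor over the complex numbers. All roots are real, and the embedding of real
  polynomials is injective, so the factorization descends. This is the input that the Schur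
  decomposition over the reals requires.\<close>

lemma symmetric_char_poly_splits:
  fixes A :: "real mat"
  assumes A: "A \<in> carrier_mat n n" and sym: "transpose_mat A = A"
  obtains es where "char_poly A = (\<Prod>a\<leftarrow>es. [:- a, 1:])" "length es = n"
proof -
  let ?B = "map_mat complex_of_real A"
  have B: "?B \<in> carrier_mat n n" using A by simp
  obtain as where as: "char_poly ?B = (\<Prod>a\<leftarrow>as. [:- a, 1:])" "length as = n"
    using char_poly_factorized[OF B] by blast
  have real: "of_real (Re a) = a" if "a \<in> set as" for a
  proof -
    have "poly (char_poly ?B) a = 0" using that by (auto simp: as poly_prod_list prod_list_zero_iff o_def)
    then have "a \<in> \<real>" by (rule symmetric_char_poly_root_real[OF A sym])
    then show ?thesis by simp
  qed
  interpret p: map_poly_inj_idom_hom complex_of_real ..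
  have "map_poly complex_of_real (\<Prod>a\<leftarrow>map Re as. [:- a, 1:]) = (\<Prod>a\<leftarrow>as. [:- a, 1:])"
    unfolding p.hom_prod_list using real
    by (intro arg_cong[of _ _ prod_list]) (simp add: o_def hom_distribs)
  also have "\<dots> = map_poly complex_of_real (char_poly A)"
    unfolding as(1)[symmetric] by (rule of_real_hom.char_poly_hom[OF A])
  finally have "char_poly A = (\<Prod>a\<leftarrow>map Re as. [:- a, 1:])"
    by simp
  with that[of "map Re as"] as(2) show ?thesis by simp
qed

section \<open>Traces, similarity and powers of triangular matrices\<close>

definition mat_trace :: "'a :: comm_monoid_add mat \<Rightarrow> 'a" where
  "mat_trace A = (\<Sum>i<dim_row A. A $$ (i, i))"

lemma mat_trace_mult:
  assumes "A \<in> carrier_mat n m" "B \<in> carrier_mat m n"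
  shows "mat_trace (A * B) = (\<Sum>i<n. \<Sum>j<m. A $$ (i, j) * B $$ (j, i))"
  using assms by (auto simp: mat_trace_def scalar_prod_def lessThan_atLeast0 intro!: sum.cong)

lemma mat_trace_mult_commute:
  fixes A :: "'a :: comm_semiring_0 mat"
  assumes "A \<in> carrier_mat n m" "B \<in> carrier_mat m n"
  shows "mat_trace (A * B) = mat_trace (B * A)"
proof -
  have "(\<Sum>i<n. \<Sum>j<m. A $$ (i, j) * B $$ (j, i)) = (\<Sum>j<m. \<Sum>i<n. A $$ (i, j) * B $$ (j, i))"
    by (rule sum.swap)
  then show ?thesis
    unfolding mat_trace_mult[OF assms] mat_trace_mult[OF assms(2,1)] by (simp only: mult.commute)
qed

lemma mat_trace_similar:
  fixes A :: "'a :: comm_ring_1 mat"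
  assumes "similar_mat A B"
  shows "mat_trace A = mat_trace B"
proof -
  obtain n P Q where *: "{A, B, P, Q} \<subseteq> carrier_mat n n" "Q * P = 1\<^sub>m n" "A = P * B * Q"
    using similar_matD[OF assms] by blast
  then have c: "P * B \<in> carrier_mat n n" "Q \<in> carrier_mat n n" by auto
  have "mat_trace A = mat_trace (Q * (P * B))"
    unfolding *(3) by (rule mat_trace_mult_commute[OF c])
  also have "Q * (P * B) = B"
    using *(1,2) assoc_mult_mat[of Q n n P n B n, symmetric] by (auto dest: left_mult_one_mat)
  finally show ?thesis .
qed

lemma upper_triangular_mult:
  fixes A B :: "'a :: comm_ring_1 mat"
  assumes A: "A \<in> carrier_mat n n" and B: "B \<in> carrier_mat n n"
    and "upper_triangular A" "upper_triangular B"
  shows "upper_triangular (A * B)" and "i < n \<Longrightarrow> (A * B) $$ (i, i) = A $$ (i, i) * B $$ (i, i)"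
proof -
  have zero: "A $$ (i, j) = 0" "B $$ (i, j) = 0" if "j < i" "i < n" for i j
    using assms that by auto
  have ent: "(A * B) $$ (i, j) = (\<Sum>k<n. A $$ (i, k) * B $$ (k, j))" if "i < n" "j < n" for i j
    using that A B by (simp add: scalar_prod_def lessThan_atLeast0)
  show "upper_triangular (A * B)"
  proof (rule upper_triangularI)
    fix i j assume "j < i" "i < dim_row (A * B)"
    then have ij: "i < n" "j < n" "j < i" using A by auto
    show "(A * B) $$ (i, j) = 0"
      unfolding ent[OF ij(1,2)]
    proof (rule sum.neutral, safe)
      fix k assume "k < n"
      then show "A $$ (i, k) * B $$ (k, j) = 0" using zero ij by (cases "k < i") auto
    qed
  qed
  assume i: "i < n"
  \<comment> \<open>The first factor vanishes for \<open>k < i\<close>, the second for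
    \<open>k > i\<close>.\<close>
  have "A $$ (i, k) * B $$ (k, i) = 0" if "k < n" "k \<noteq> i" for k
    using zero i that by (cases "k < i") auto
  then have "(\<Sum>k<n. A $$ (i, k) * B $$ (k, i)) = (\<Sum>k\<in>{i}. A $$ (i, k) * B $$ (k, i))"
    using i by (intro sum.mono_neutral_right) auto
  then show "(A * B) $$ (i, i) = A $$ (i, i) * B $$ (i, i)" using ent[OF i i] by simp
qed

lemma upper_triangular_pow:
  fixes A :: "'a :: comm_ring_1 mat"
  assumes A: "A \<in> carrier_mat n n" and "upper_triangular A"
  shows "upper_triangular (A ^\<^sub>m k)" and "i < n \<Longrightarrow> (A ^\<^sub>m k) $$ (i, i) = (A $$ (i, i)) ^ k"
proof -
  have "upper_triangular (A ^\<^sub>m k) \<and> (\<forall>i<n. (A ^\<^sub>m k) $$ (i, i) = (A $$ (i, i)) ^ k)"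
  proof (induction k)
    case 0
    then show ?case using A by simp
  next
    case (Suc k)
    then show ?case
      using upper_triangular_mult[OF pow_carrier_mat[OF A] A _ assms(2)] by (simp add: mult.commute)
  qed
  then show "upper_triangular (A ^\<^sub>m k)" "i < n \<Longrightarrow> (A ^\<^sub>m k) $$ (i, i) = (A $$ (i, i)) ^ k"
    by auto
qed

text \<open>\<open>A\<close> is similar to an upper triangular \<open>B\<close> whose diagonal lists
  the spectrum with multiplicity. Powers preserve the similarity, and the diagonal of a power of
  \<open>B\<close> consists of the powers of its diagonal entries.\<close>

lemma symmetric_spectrum:
  fixes A :: "real mat"
  assumes A: "A \<in> carrier_mat n n" and sym: "transpose_mat A = A"
  shows size_spectrum_mset: "size (spectrum_mset A) = n"
    and mat_trace_pow: "mat_trace (A ^\<^sub>m k) = (\<Sum>\<mu>\<in>#spectrum_mset A. \<mu> ^ k)"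
proof -
  obtain es where es: "char_poly A = (\<Prod>a\<leftarrow>es. [:- a, 1:])" "length es = n"
    by (rule symmetric_char_poly_splits[OF A sym])
  then show "size (spectrum_mset A) = n"
    by (simp add: spectrum_mset_def proots_prod_list_linear)
  obtain B where B: "B \<in> carrier_mat n n" "upper_triangular B" "similar_mat A B"
    using schur_decomposition_exists[OF A es(1)] by blast
  have "spectrum_mset A = mset (diag_mat B)"
    unfolding spectrum_mset_def char_poly_similar[OF B(3)] char_poly_upper_triangular[OF B(1,2)]
    by (rule proots_prod_list_linear)
  then have "(\<Sum>\<mu>\<in>#spectrum_mset A. \<mu> ^ k) = (\<Sum>\<mu>\<leftarrow>diag_mat B. \<mu> ^ k)"
    by (metis mset_map sum_mset_sum_list)
  also have "\<dots> = (\<Sum>i<n. (B $$ (i, i)) ^ k)"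
    using B(1) by (simp add: diag_mat_def o_def interv_sum_list_conv_sum_set_nat lessThan_atLeast0)
  also have "\<dots> = mat_trace (B ^\<^sub>m k)"
    using B by (simp add: mat_trace_def upper_triangular_pow)
  also have "\<dots> = mat_trace (A ^\<^sub>m k)"
    using B(3) unfolding similar_mat_def
    by (metis mat_trace_similar similar_mat_def similar_mat_wit_pow)
  finally show "mat_trace (A ^\<^sub>m k) = (\<Sum>\<mu>\<in>#spectrum_mset A. \<mu> ^ k)" ..
qed

section \<open>The spectral bound on the complement of the constants\<close>

lemma pow_mat_add:
  assumes A: "A \<in> carrier_mat n n"
  shows "A ^\<^sub>m (k + l) = A ^\<^sub>m k * A ^\<^sub>m l"
proof (induction l)
  case 0
  then show ?case using A pow_carrier_mat[OF A, of k] by simp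
next
  case (Suc l)
  then show ?case
    using assoc_mult_mat[OF pow_carrier_mat[OF A] pow_carrier_mat[OF A] A] by simp
qed

lemma transpose_pow_mat:
  fixes A :: "'a :: comm_semiring_1 mat"
  assumes A: "A \<in> carrier_mat n n" and sym: "transpose_mat A = A"
  shows "transpose_mat (A ^\<^sub>m k) = A ^\<^sub>m k"
proof (induction k)
  case (Suc k)
  have "transpose_mat (A ^\<^sub>m Suc k) = A * A ^\<^sub>m k"
    using transpose_mult[OF pow_carrier_mat[OF A] A] Suc sym by simp
  also have "\<dots> = A ^\<^sub>m (1 + k)"
    unfolding pow_mat_add[OF A] using A by simp
  finally show ?case by simp
qed (use A in simp)

text \<open>The all-ones vector is an eigenvector of \<open>A\<close> for \<open>s\<close>, hence of
  each power for the power of \<open>s\<close>. This makes deflation applicable to powers of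
  \<open>A\<close>.\<close>

lemma row_sum_pow_mat:
  fixes A :: "'a :: comm_semiring_1 mat"
  assumes A: "A \<in> carrier_mat n n" and row: "\<And>i. i < n \<Longrightarrow> (\<Sum>j<n. A $$ (i, j)) = s"
    and i: "i < n"
  shows "(\<Sum>j<n. (A ^\<^sub>m k) $$ (i, j)) = s ^ k"
proof (induction k)
  case 0
  have "(\<Sum>j<n. (A ^\<^sub>m 0) $$ (i, j)) = (\<Sum>j<n. if i = j then 1 else 0)"
    using A i by (intro sum.cong) auto
  then show ?case using i by simp
next
  case (Suc k)
  have "(\<Sum>j<n. (A ^\<^sub>m Suc k) $$ (i, j)) = (\<Sum>j<n. \<Sum>l<n. (A ^\<^sub>m k) $$ (i, l) * A $$ (l, j))"
    using A i by (intro sum.cong) (auto simp: scalar_prod_def lessThan_atLeast0)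
  also have "\<dots> = (\<Sum>l<n. (A ^\<^sub>m k) $$ (i, l) * (\<Sum>j<n. A $$ (l, j)))"
    by (subst sum.swap) (simp add: sum_distrib_left)
  also have "\<dots> = (\<Sum>l<n. (A ^\<^sub>m k) $$ (i, l)) * s"
    by (simp add: row sum_distrib_right)
  finally show ?case by (simp add: Suc mult.commute)
qed

section \<open>Norm growth under repeated squaring, and deflation\<close>

lemma scalar_prod_Cauchy_Schwarz:
  fixes x y :: "real vec"
  assumes "x \<in> carrier_vec n" "y \<in> carrier_vec n"
  shows "(x \<bullet> y)\<^sup>2 \<le> (x \<bullet> x) * (y \<bullet> y)"
  using Cauchy_Schwarz_ineq_sum[of "($) x" "($) y" "{0..<n}"] assms
  by (simp add: scalar_prod_def power2_eq_square)

lemma scalar_prod_self_nonneg: "0 \<le> (x :: real vec) \<bullet> x"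
  by (simp add: scalar_prod_def sum_nonneg)

text \<open>Moving one factor \<open>B\<close> across the scalar product gives
  \<open>x \<bullet> (B * B) x\<close>, to which Cauchy-Schwarz applies. Each use doubles the power
  of the matrix.\<close>

lemma symmetric_mult_norm_sq:
  fixes B :: "real mat"
  assumes B: "B \<in> carrier_mat n n" and sym: "transpose_mat B = B" and x: "x \<in> carrier_vec n"
  shows "((B *\<^sub>v x) \<bullet> (B *\<^sub>v x))\<^sup>2 \<le> (x \<bullet> x) * (((B * B) *\<^sub>v x) \<bullet> ((B * B) *\<^sub>v x))"
proof -
  have "(B *\<^sub>v x) \<bullet> (B *\<^sub>v x) = x \<bullet> (B *\<^sub>v (B *\<^sub>v x))"
    using transpose_vec_mult_scalar[OF B mult_mat_vec_carrier[OF B x] x] sym by simp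
  also have "B *\<^sub>v (B *\<^sub>v x) = (B * B) *\<^sub>v x"
    using assoc_mult_mat_vec[OF B B x] by simp
  finally show ?thesis
    using scalar_prod_Cauchy_Schwarz[OF x mult_mat_vec_carrier[OF mult_carrier_mat[OF B B] x]] by simp
qed

text \<open>The factor \<open>x \<bullet> x\<close> stays on both sides instead of being divided
  out, so that \<open>x = 0\<close> is covered.\<close>

lemma symmetric_norm_sq_power:
  fixes A :: "real mat"
  assumes A: "A \<in> carrier_mat n n" and sym: "transpose_mat A = A" and x: "x \<in> carrier_vec n"
  shows "(x \<bullet> x) * ((A *\<^sub>v x) \<bullet> (A *\<^sub>v x)) ^ 2 ^ m
    \<le> (x \<bullet> x) ^ 2 ^ m * ((A ^\<^sub>m 2 ^ m *\<^sub>v x) \<bullet> (A ^\<^sub>m 2 ^ m *\<^sub>v x))"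
proof (induction m)
  case 0
  then show ?case using A by simp
next
  case (Suc m)
  define X where "X = x \<bullet> x"
  define a where "a = (A *\<^sub>v x) \<bullet> (A *\<^sub>v x)"
  let ?B = "A ^\<^sub>m 2 ^ m"
  define b where "b = (?B *\<^sub>v x) \<bullet> (?B *\<^sub>v x)"
  define c where "c = (A ^\<^sub>m 2 ^ Suc m *\<^sub>v x) \<bullet> (A ^\<^sub>m 2 ^ Suc m *\<^sub>v x)"
  have X: "0 \<le> X" and "0 \<le> a" "0 \<le> c" by (auto simp: X_def a_def c_def scalar_prod_self_nonneg)
  have "A ^\<^sub>m 2 ^ Suc m = ?B * ?B"
    unfolding pow_mat_add[OF A, symmetric] by (simp add: mult_2)
  then have bc: "b\<^sup>2 \<le> X * c"
    unfolding b_def c_def X_def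
    using symmetric_mult_norm_sq[OF pow_carrier_mat[OF A] transpose_pow_mat[OF A sym] x] by simp
  \<comment> \<open>One more factor \<open>X\<close> makes the left side the square of that of the
    induction hypothesis; it is cancelled at the end.\<close>
  have "X * (X * a ^ 2 ^ Suc m) = (X * a ^ 2 ^ m)\<^sup>2"
    by (simp add: power2_eq_square power_add mult_2 mult_ac)
  also have "\<dots> \<le> (X ^ 2 ^ m * b)\<^sup>2"
    using Suc X \<open>0 \<le> a\<close> unfolding X_def a_def b_def by (intro power_mono) auto
  also have "\<dots> = X ^ 2 ^ Suc m * b\<^sup>2"
    by (simp add: power2_eq_square power_add mult_2 mult_ac)
  also have "\<dots> \<le> X ^ 2 ^ Suc m * (X * c)"
    using bc X by (intro mult_left_mono) auto
  finally have "X * (X * a ^ 2 ^ Suc m) \<le> X * (X ^ 2 ^ Suc m * c)"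
    by (simp add: mult_ac)
  then have "X * a ^ 2 ^ Suc m \<le> X ^ 2 ^ Suc m * c"
    using X \<open>0 \<le> c\<close> by (cases "X = 0") auto
  then show ?case by (simp add: X_def a_def c_def)
qed

text \<open>Subtracting \<open>(s / n) J\<close> from \<open>B\<close> does not change \<open>B x\<close>, and lowers the squared Frobenius
  norm \<open>tr (B\<^sup>2)\<close> by exactly \<open>s\<^sup>2\<close>.\<close>

lemma deflated_norm_sq_le:
  fixes B :: "real mat"
  assumes B: "B \<in> carrier_mat n n" and sym: "transpose_mat B = B"
    and row: "\<And>i. i < n \<Longrightarrow> (\<Sum>j<n. B $$ (i, j)) = s"
    and x: "x \<in> carrier_vec n" and x0: "(\<Sum>j<n. x $ j) = 0" and n: "0 < n"
  shows "(B *\<^sub>v x) \<bullet> (B *\<^sub>v x) \<le> (mat_trace (B * B) - s\<^sup>2) * (x \<bullet> x)"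
proof -
  \<comment> \<open>With this coefficient all row sums of \<open>B\<close> minus \<open>c\<close>
    times the all-ones matrix are zero. The cross term then contributes -2 s^2 and the constant term
    s^2.\<close>
  define c where "c = s / real n"
  have Bx: "(B *\<^sub>v x) $ i = (\<Sum>j<n. (B $$ (i, j) - c) * x $ j)" if "i < n" for i
  proof -
    have "(\<Sum>j<n. (B $$ (i, j) - c) * x $ j) = (\<Sum>j<n. B $$ (i, j) * x $ j) - c * (\<Sum>j<n. x $ j)"
      by (simp add: algebra_simps sum_subtractf sum_distrib_left)
    then show ?thesis using that B x x0 by (simp add: scalar_prod_def lessThan_atLeast0)
  qed
  have sym': "B $$ (j, i) = B $$ (i, j)" if "i < n" "j < n" for i j
    using sym that B by (metis carrier_matD index_transpose_mat(1))
  have "(B *\<^sub>v x) \<bullet> (B *\<^sub>v x) = (\<Sum>i<n. ((B *\<^sub>v x) $ i)\<^sup>2)"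
    using B by (simp add: scalar_prod_def lessThan_atLeast0 power2_eq_square)
  also have "\<dots> \<le> (\<Sum>i<n. (\<Sum>j<n. (B $$ (i, j) - c)\<^sup>2) * (\<Sum>j<n. (x $ j)\<^sup>2))"
    by (intro sum_mono) (simp only: Bx lessThan_iff Cauchy_Schwarz_ineq_sum)
  also have "\<dots> = (\<Sum>i<n. \<Sum>j<n. (B $$ (i, j) - c)\<^sup>2) * (x \<bullet> x)"
    using x by (simp add: sum_distrib_right scalar_prod_def lessThan_atLeast0 power2_eq_square)
  also have "(\<Sum>i<n. \<Sum>j<n. (B $$ (i, j) - c)\<^sup>2)
      = (\<Sum>i<n. (\<Sum>j<n. (B $$ (i, j))\<^sup>2) - 2 * c * (\<Sum>j<n. B $$ (i, j)) + n * c\<^sup>2)"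
    by (simp add: power2_diff sum.distrib sum_subtractf sum_distrib_left mult_ac)
  also have "\<dots> = (\<Sum>i<n. \<Sum>j<n. (B $$ (i, j))\<^sup>2) - n * (2 * c * s) + n * (n * c\<^sup>2)"
    by (simp add: row sum.distrib sum_subtractf)
  also have "\<dots> = (\<Sum>i<n. \<Sum>j<n. (B $$ (i, j))\<^sup>2) - s\<^sup>2"
    using n by (simp add: c_def power2_eq_square)
  also have "(\<Sum>i<n. \<Sum>j<n. (B $$ (i, j))\<^sup>2) = mat_trace (B * B)"
    unfolding mat_trace_mult[OF B B] by (intro sum.cong refl) (simp add: sym' power2_eq_square)
  finally show ?thesis .
qed

text \<open>If \<open>a\<close> exceeded \<open>b\<close>, the powers of \<open>a / b\<close> would
  outgrow the constant \<open>c\<close>.\<close>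

lemma le_of_power_le_mult:
  fixes a b c :: real
  assumes "0 \<le> b" and le: "\<And>m. a ^ 2 ^ m \<le> c * b ^ 2 ^ m"
  shows "a \<le> b"
proof (rule ccontr)
  assume "\<not> a \<le> b"
  then have ab: "b < a" "0 < a" using assms(1) by auto
  \<comment> \<open>The case \<open>m = 0\<close> reads \<open>a \<le> c * b\<close>, which excludes
    \<open>b = 0\<close> because \<open>a\<close> is positive.\<close>
  have "b \<noteq> 0" using le[of 0] ab by auto
  then have b: "0 < b" using assms(1) by simp
  then have gt: "1 < a / b" using ab by simp
  then obtain m where m: "c < (a / b) ^ m" using real_arch_pow by blast
  have "m \<le> 2 ^ m" by (simp add: less_imp_le)
  then have "c < (a / b) ^ 2 ^ m"
    using m power_increasing[of m "2 ^ m" "a / b"] gt by linarith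
  then show False using le[of m] b by (simp add: power_divide field_simps)
qed

lemma symmetric_norm_sq_le:
  fixes A :: "real mat"
  assumes A: "A \<in> carrier_mat n n" and sym: "transpose_mat A = A"
    and row: "\<And>i. i < n \<Longrightarrow> (\<Sum>j<n. A $$ (i, j)) = s" and s: "s \<in># spectrum_mset A"
    and rest: "\<And>\<mu>. \<mu> \<in># spectrum_mset A - {#s#} \<Longrightarrow> \<bar>\<mu>\<bar> \<le> lam"
    and x: "x \<in> carrier_vec n" and x0: "(\<Sum>j<n. x $ j) = 0"
  shows "(A *\<^sub>v x) \<bullet> (A *\<^sub>v x) \<le> lam\<^sup>2 * (x \<bullet> x)"
proof (rule le_of_power_le_mult)
  show "0 \<le> lam\<^sup>2 * (x \<bullet> x)" by (simp add: scalar_prod_self_nonneg)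
  fix m :: nat
  let ?N = "2 ^ m :: nat"
  let ?R = "spectrum_mset A - {#s#}"
  have n: "0 < n" using size_spectrum_mset[OF A sym] s by (cases n) auto
  have R: "spectrum_mset A = add_mset s ?R" using s by simp
  have "(\<Sum>\<mu>\<in>#?R. \<mu> ^ (2 * ?N)) \<le> (\<Sum>\<mu>\<in>#?R. (lam\<^sup>2) ^ ?N)"
  proof (rule sum_mset_mono)
    fix \<mu> assume "\<mu> \<in># ?R"
    \<comment> \<open>Passing to absolute values lets the comparison be squared.\<close>
    then have "\<bar>\<mu>\<bar> \<le> \<bar>lam\<bar>" using rest[of \<mu>] by simp
    then have "\<mu>\<^sup>2 \<le> lam\<^sup>2" by (simp only: abs_le_square_iff)
    then show "\<mu> ^ (2 * ?N) \<le> (lam\<^sup>2) ^ ?N" unfolding power_mult by (rule power_mono) simp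
  qed
  \<comment> \<open>\<open>?R\<close> has \<open>n - 1\<close> elements; rounding up to
    \<open>n\<close> is harmless since constant factors disappear in the limit.\<close>
  also have "\<dots> \<le> n * (lam\<^sup>2) ^ ?N"
    using size_spectrum_mset[OF A sym] by (subst (asm) R) (auto intro!: mult_right_mono)
  finally have tr: "mat_trace (A ^\<^sub>m (2 * ?N)) - (s ^ ?N)\<^sup>2 \<le> n * (lam\<^sup>2) ^ ?N"
    unfolding mat_trace_pow[OF A sym] by (subst R) (simp add: power_mult[symmetric] mult.commute)
  define X where "X = x \<bullet> x"
  define a where "a = (A *\<^sub>v x) \<bullet> (A *\<^sub>v x)"
  have X: "0 \<le> X" by (simp add: X_def scalar_prod_self_nonneg)
  have "X * a ^ ?N \<le> X ^ ?N * ((A ^\<^sub>m ?N *\<^sub>v x) \<bullet> (A ^\<^sub>m ?N *\<^sub>v x))"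
    unfolding X_def a_def by (rule symmetric_norm_sq_power[OF A sym x])
  also have "\<dots> \<le> X ^ ?N * ((mat_trace (A ^\<^sub>m (2 * ?N)) - (s ^ ?N)\<^sup>2) * X)"
    unfolding X_def mult_2 pow_mat_add[OF A]
    by (intro mult_left_mono deflated_norm_sq_le[OF pow_carrier_mat[OF A] transpose_pow_mat[OF A sym]
          row_sum_pow_mat[OF A row] x x0 n] zero_le_power scalar_prod_self_nonneg)
  also have "\<dots> \<le> X ^ ?N * ((n * (lam\<^sup>2) ^ ?N) * X)"
    using tr X by (intro mult_left_mono mult_right_mono) auto
  finally have *: "X * a ^ ?N \<le> X * (n * (lam\<^sup>2 * X) ^ ?N)"
    by (simp add: power_mult_distrib mult_ac)
  \<comment> \<open>For nonzero \<open>X\<close> the common factor cancels. For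
    \<open>X = 0\<close>, deflation applied to \<open>A\<close> itself forces
    \<open>a = 0\<close>.\<close>
  show "a ^ ?N \<le> n * (lam\<^sup>2 * X) ^ ?N"
  proof (cases "X = 0")
    case True
    have "a \<le> (mat_trace (A * A) - s\<^sup>2) * X"
      unfolding a_def X_def by (rule deflated_norm_sq_le[OF A sym row x x0 n])
    then have "a = 0" using True scalar_prod_self_nonneg[of "A *\<^sub>v x"] by (simp add: a_def)
    then show ?thesis using True by (simp add: zero_power)
  next
    case False
    then show ?thesis using * X by simp
  qed
qed

section \<open>The constant row sum as the largest eigenvalue\<close>

lemma row_sum_eigenvalue:
  fixes A :: "real mat"
  assumes A: "A \<in> carrier_mat n n" and row: "\<And>i. i < n \<Longrightarrow> (\<Sum>j<n. A $$ (i, j)) = s"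
    and n: "0 < n"
  shows "s \<in># spectrum_mset A"
proof -
  have "A *\<^sub>v vec n (\<lambda>_. 1) = s \<cdot>\<^sub>v vec n (\<lambda>_. 1)"
    using A row by (intro eq_vecI) (auto simp: scalar_prod_def lessThan_atLeast0)
  \<comment> \<open>An eigenvector must be nonzero, which is where \<open>0 < n\<close>
    enters.\<close>
  moreover have "vec n (\<lambda>_. 1) \<noteq> (0\<^sub>v n :: real vec)"
    using n by (metis index_vec index_zero_vec(1) zero_neq_one)
  ultimately have "eigenvalue A s"
    using A unfolding eigenvalue_def eigenvector_def by (metis carrier_matD(1) vec_carrier)
  then have "poly (char_poly A) s = 0" using eigenvalue_root_char_poly[OF A] by simp
  moreover have "char_poly A \<noteq> 0" using degree_monic_char_poly[OF A] by auto
  ultimately show ?thesis by (simp add: spectrum_mset_def)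
qed

text \<open>Read the eigenvector equation in a row \<open>i\<close> where the entry of
  \<open>v\<close> has maximal absolute value: the nonnegative weights of that row sum to
  \<open>s\<close>.\<close>

lemma eigenvalue_le_row_sum:
  fixes A :: "real mat"
  assumes A: "A \<in> carrier_mat n n" and row: "\<And>i. i < n \<Longrightarrow> (\<Sum>j<n. A $$ (i, j)) = s"
    and nonneg: "\<And>i j. i < n \<Longrightarrow> j < n \<Longrightarrow> 0 \<le> A $$ (i, j)"
    and \<mu>: "\<mu> \<in># spectrum_mset A"
  shows "\<mu> \<le> s"
proof -
  have "char_poly A \<noteq> 0" using degree_monic_char_poly[OF A] by auto
  then have "eigenvalue A \<mu>"
    using \<mu> eigenvalue_root_char_poly[OF A] by (simp add: spectrum_mset_def)
  then obtain v where v: "v \<in> carrier_vec n" "v \<noteq> 0\<^sub>v n" "A *\<^sub>v v = \<mu> \<cdot>\<^sub>v v"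
    using A unfolding eigenvalue_def eigenvector_def by auto
  then obtain k where k: "k < n" "v $ k \<noteq> 0" by (metis carrier_vecD eq_vecI index_zero_vec)
  have "Max ((\<lambda>j. \<bar>v $ j\<bar>) ` {..<n}) \<in> (\<lambda>j. \<bar>v $ j\<bar>) ` {..<n}"
    using k by (intro Max_in) auto
  then obtain i where i: "i < n" and "Max ((\<lambda>j. \<bar>v $ j\<bar>) ` {..<n}) = \<bar>v $ i\<bar>" by auto
  then have max: "\<bar>v $ j\<bar> \<le> \<bar>v $ i\<bar>" if "j < n" for j
    using Max_ge[of "(\<lambda>j. \<bar>v $ j\<bar>) ` {..<n}" "\<bar>v $ j\<bar>"] that by auto
  have "\<mu> * v $ i = (A *\<^sub>v v) $ i" using v i by simp
  also have "\<dots> = (\<Sum>j<n. A $$ (i, j) * v $ j)"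
    using A v(1) i by (simp add: scalar_prod_def lessThan_atLeast0)
  finally have "\<bar>\<mu>\<bar> * \<bar>v $ i\<bar> = \<bar>\<Sum>j<n. A $$ (i, j) * v $ j\<bar>" by (simp flip: abs_mult)
  also have "\<dots> \<le> (\<Sum>j<n. \<bar>A $$ (i, j) * v $ j\<bar>)" by (rule sum_abs)
  also have "\<dots> \<le> (\<Sum>j<n. A $$ (i, j) * \<bar>v $ i\<bar>)"
    using nonneg i max by (intro sum_mono) (simp add: abs_mult mult_left_mono)
  also have "\<dots> = s * \<bar>v $ i\<bar>" by (simp add: row i flip: sum_distrib_right)
  \<comment> \<open>The nonzero entry at \<open>k\<close> makes the maximal entry nonzero, so it
    cancels.\<close>
  finally have "\<bar>\<mu>\<bar> \<le> s" using k max[of k] by (simp add: mult_le_cancel_right)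
  then show ?thesis by simp
qed

section \<open>Regular graphs\<close>

lemma ndl_graph_neighbours:
  assumes "ndl_graph n d lam H"
  shows ndl_graph_wf: "(v, u) \<in> parcs H \<Longrightarrow> v \<in> pverts H \<and> u \<in> pverts H"
    and ndl_graph_sym: "(v, u) \<in> parcs H \<Longrightarrow> (u, v) \<in> parcs H"
    and ndl_graph_loopfree: "(v, v) \<notin> parcs H"
    and ndl_graph_finite: "finite (pverts H)"
    and ndl_graph_degree: "v \<in> pverts H \<Longrightarrow> card {u. (v, u) \<in> parcs H} = d"
proof -
  interpret pair_graph H using assms by (simp add: ndl_graph_def)
  show "(v, u) \<in> parcs H \<Longrightarrow> v \<in> pverts H \<and> u \<in> pverts H"
    using in_arcsD1 in_arcsD2 by blast
  show "(v, u) \<in> parcs H \<Longrightarrow> (u, v) \<in> parcs H"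
    using pair_sym_arcs by (auto simp: symmetric_def sym_def)
  show "(v, v) \<notin> parcs H"
    using pair_no_loops by fastforce
  show "finite (pverts H)" by (rule pair_finite_verts)
  have "out_arcs (with_proj H) v = Pair v ` {u. (v, u) \<in> parcs H}"
    by (auto simp: out_arcs_def)
  then have "out_degree (with_proj H) v = card {u. (v, u) \<in> parcs H}"
    by (simp add: out_degree_def card_image inj_on_def)
  then show "v \<in> pverts H \<Longrightarrow> card {u. (v, u) \<in> parcs H} = d"
    using assms by (simp add: ndl_graph_def)
qed

lemma adj_matrix_regular:
  assumes H: "ndl_graph n d lam H" and vs: "distinct vs" "set vs = pverts H"
  shows "adj_matrix H vs \<in> carrier_mat n n" "transpose_mat (adj_matrix H vs) = adj_matrix H vs"
    and sum_adj_matrix: "\<And>i f. i < n \<Longrightarrow>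
      (\<Sum>j<n. adj_matrix H vs $$ (i, j) * f (vs ! j)) = (\<Sum>u | (vs ! i, u) \<in> parcs H. f u)"
    and row_sum_adj_matrix: "\<And>i. i < n \<Longrightarrow> (\<Sum>j<n. adj_matrix H vs $$ (i, j)) = d"
proof -
  have len: "length vs = n"
    using H vs distinct_card[OF vs(1)] by (simp add: ndl_graph_def)
  show A: "adj_matrix H vs \<in> carrier_mat n n" by (simp add: adj_matrix_def len)
  show "transpose_mat (adj_matrix H vs) = adj_matrix H vs"
    using ndl_graph_sym[OF H] by (intro eq_matI) (auto simp: adj_matrix_def)
  show sum: "(\<Sum>j<n. adj_matrix H vs $$ (i, j) * f (vs ! j)) = (\<Sum>u | (vs ! i, u) \<in> parcs H. f u)"
    if "i < n" for i f
  proof -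
    have "(\<Sum>j<n. adj_matrix H vs $$ (i, j) * f (vs ! j))
        = (\<Sum>j<n. if (vs ! i, vs ! j) \<in> parcs H then f (vs ! j) else 0)"
      using that by (intro sum.cong) (auto simp: adj_matrix_def len)
    also have "\<dots> = (\<Sum>u\<in>pverts H. if (vs ! i, u) \<in> parcs H then f u else 0)"
      using bij_betw_nth[OF vs(1) refl refl] unfolding vs(2) len
      by (rule sum.reindex_bij_betw)
    also have "\<dots> = (\<Sum>u | u \<in> pverts H \<and> (vs ! i, u) \<in> parcs H. f u)"
      by (rule sum.inter_filter[OF ndl_graph_finite[OF H], symmetric])
    also have "{u. u \<in> pverts H \<and> (vs ! i, u) \<in> parcs H} = {u. (vs ! i, u) \<in> parcs H}"
      using ndl_graph_wf[OF H] by blast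
    finally show ?thesis .
  qed
  show "(\<Sum>j<n. adj_matrix H vs $$ (i, j)) = d" if "i < n" for i
  proof -
    have "vs ! i \<in> pverts H" using that nth_mem[of i vs] unfolding vs(2) len by simp
    then show ?thesis using sum[OF that, of "\<lambda>_. 1"] by (simp add: ndl_graph_degree[OF H])
  qed
qed

text \<open>Identifies the \<open>Max\<close> removed in \<open>ndl_graph\<close> with the degree
  \<open>d\<close>, the eigenvalue of the constant vector, so that deflation removes the same
  eigenvalue.\<close>

lemma ndl_graph_second_eigenvalue:
  assumes H: "ndl_graph n d lam H" and n: "0 < n"
  obtains vs where "distinct vs" "set vs = pverts H"
    "real d \<in># spectrum_mset (adj_matrix H vs)"
    "\<And>\<mu>. \<mu> \<in># spectrum_mset (adj_matrix H vs) - {#real d#} \<Longrightarrow> \<bar>\<mu>\<bar> \<le> lam"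
proof -
  obtain vs where vs: "distinct vs" "set vs = pverts H"
    and bound: "\<And>\<mu>. \<mu> \<in># spectrum_mset (adj_matrix H vs)
      - {#Max (set_mset (spectrum_mset (adj_matrix H vs)))#} \<Longrightarrow> \<bar>\<mu>\<bar> \<le> lam"
    using H by (auto simp: ndl_graph_def Let_def)
  note A = adj_matrix_regular[OF H vs]
  have d: "real d \<in># spectrum_mset (adj_matrix H vs)"
    by (rule row_sum_eigenvalue[OF A(1) A(4) n])
  have "Max (set_mset (spectrum_mset (adj_matrix H vs))) = d"
  proof (intro Max_eqI d)
    fix \<mu> assume "\<mu> \<in># spectrum_mset (adj_matrix H vs)"
    then show "\<mu> \<le> d"
      by (rule eigenvalue_le_row_sum[OF A(1) A(4), rotated 2])
        (use A(1) in \<open>auto simp: adj_matrix_def\<close>)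
  qed simp
  then show ?thesis using that[OF vs d] bound by simp
qed

text \<open>Transfers the matrix bound to functions on vertices, where the adjacency matrix acts by
  summing over neighbours. The empty graph is separate because its spectrum is empty and does not
  contain \<open>d\<close>.\<close>

lemma ndl_graph_norm_sq_le:
  fixes H :: "'a pair_pre_digraph" and f :: "'a \<Rightarrow> real"
  assumes H: "ndl_graph n d lam H" and f: "(\<Sum>v\<in>pverts H. f v) = 0"
  shows "(\<Sum>v\<in>pverts H. (\<Sum>u | (v, u) \<in> parcs H. f u)\<^sup>2) \<le> lam\<^sup>2 * (\<Sum>v\<in>pverts H. (f v)\<^sup>2)"
proof (cases "n = 0")
  case True
  then have "pverts H = {}" using H ndl_graph_finite[OF H] by (auto simp: ndl_graph_def)
  then show ?thesis by simp
next
  case False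
  then obtain vs where vs: "distinct vs" "set vs = pverts H"
    and d: "real d \<in># spectrum_mset (adj_matrix H vs)"
    and rest: "\<And>\<mu>. \<mu> \<in># spectrum_mset (adj_matrix H vs) - {#real d#} \<Longrightarrow> \<bar>\<mu>\<bar> \<le> lam"
    using ndl_graph_second_eigenvalue[OF H] by auto
  note A = adj_matrix_regular[OF H vs]
  have len: "length vs = n"
    using H vs distinct_card[OF vs(1)] by (simp add: ndl_graph_def)
  have reindex: "(\<Sum>i<n. h (vs ! i)) = (\<Sum>v\<in>pverts H. h v)" for h :: "'a \<Rightarrow> real"
    using bij_betw_nth[OF vs(1) refl refl] unfolding vs(2) len
    by (rule sum.reindex_bij_betw)
  define x where "x = vec n (\<lambda>i. f (vs ! i))"
  have Ax: "(adj_matrix H vs *\<^sub>v x) $ i = (\<Sum>u | (vs ! i, u) \<in> parcs H. f u)" if "i < n" for i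
    using that A(1) A(3)[OF that, of f] by (simp add: x_def scalar_prod_def lessThan_atLeast0)
  have "(adj_matrix H vs *\<^sub>v x) \<bullet> (adj_matrix H vs *\<^sub>v x) \<le> lam\<^sup>2 * (x \<bullet> x)"
    by (rule symmetric_norm_sq_le[OF A(1,2,4) d rest])
      (use f in \<open>simp_all add: x_def reindex\<close>)
  also have "x \<bullet> x = (\<Sum>i<n. (f (vs ! i))\<^sup>2)"
    by (simp add: x_def scalar_prod_def lessThan_atLeast0 power2_eq_square)
  also have "(adj_matrix H vs *\<^sub>v x) \<bullet> (adj_matrix H vs *\<^sub>v x)
      = (\<Sum>i<n. (\<Sum>u | (vs ! i, u) \<in> parcs H. f u)\<^sup>2)"
    using A(1) Ax unfolding scalar_prod_def by (simp add: lessThan_atLeast0 power2_eq_square)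
  finally show ?thesis
    using reindex[of "\<lambda>v. (f v)\<^sup>2"] reindex[of "\<lambda>v. (\<Sum>u | (v, u) \<in> parcs H. f u)\<^sup>2"] by simp
qed

text \<open>For a single vertex there is no second eigenvalue, and \<open>lam\<close> may be negative.\<close>

lemma ndl_graph_lam_nonneg:
  assumes H: "ndl_graph n d lam H" and "0 < d" "0 < n"
  shows "0 \<le> lam"
proof -
  obtain vs where vs: "distinct vs" "set vs = pverts H"
    and d: "real d \<in># spectrum_mset (adj_matrix H vs)"
    and rest: "\<And>\<mu>. \<mu> \<in># spectrum_mset (adj_matrix H vs) - {#real d#} \<Longrightarrow> \<bar>\<mu>\<bar> \<le> lam"
    using ndl_graph_second_eigenvalue[OF H \<open>0 < n\<close>] by blast
  have n: "card (pverts H) = n" using H by (simp add: ndl_graph_def)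
  then obtain v where v: "v \<in> pverts H" using \<open>0 < n\<close> by fastforce
  \<comment> \<open>A vertex of positive degree has a neighbour other than itself, so there are two
    vertices and a second eigenvalue, whose absolute value lies below \<open>lam\<close>.\<close>
  have "{u. (v, u) \<in> parcs H} \<subseteq> pverts H - {v}"
    using ndl_graph_wf[OF H] ndl_graph_loopfree[OF H] by blast
  then have "d \<le> card (pverts H - {v})"
    unfolding ndl_graph_degree[OF H v, symmetric]
    using ndl_graph_finite[OF H] by (intro card_mono) auto
  then have "1 < n" using \<open>0 < d\<close> n v by (simp add: card_Diff_singleton)
  then have "size (spectrum_mset (adj_matrix H vs) - {#real d#}) \<noteq> 0"
    using d size_spectrum_mset[OF adj_matrix_regular(1,2)[OF H vs]] by (simp add: size_Diff_singleton)
  then obtain \<mu> where "\<mu> \<in># spectrum_mset (adj_matrix H vs) - {#real d#}"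
    by (metis multiset_nonemptyE size_empty)
  from rest[OF this] show ?thesis by linarith
qed

text \<open>Apply the spectral bound to the indicator function of \<open>E\<close> minus its average.\<close>

lemma ndl_graph_degree_deviation:
  fixes H :: "'a pair_pre_digraph" and E :: "'a set"
  assumes H: "ndl_graph n d lam H" and E: "E \<subseteq> pverts H"
  shows "(\<Sum>v\<in>E. (real (card {u \<in> E. (v, u) \<in> parcs H}) - real d / real n * real (card E))\<^sup>2)
    \<le> lam\<^sup>2 * real (card E)"
proof (cases "n = 0")
  case True
  then have "pverts H = {}" using H ndl_graph_finite[OF H] by (auto simp: ndl_graph_def)
  then show ?thesis using E by simp
next
  case False
  \<comment> \<open>The density of \<open>E\<close> is the average of its indicator, so
    \<open>f\<close> sums to zero; by regularity the neighbour sums of \<open>f\<close> are the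
    deviations to be bounded.\<close>
  define \<alpha> where "\<alpha> = real (card E) / real n"
  define f where "f u = of_bool (u \<in> E) - \<alpha>" for u
  have fin: "finite (pverts H)" by (rule ndl_graph_finite[OF H])
  then have finE: "finite E" using E finite_subset by blast
  have n: "card (pverts H) = n" using H by (simp add: ndl_graph_def)
  have ind: "(\<Sum>u\<in>S. of_bool (u \<in> E) :: real) = real (card (S \<inter> E))" if "finite S" for S :: "'a set"
    using that by (simp add: Int_def)
  have PE: "pverts H \<inter> E = E" using E by blast
  have f0: "(\<Sum>v\<in>pverts H. f v) = 0"
    using False by (simp add: f_def sum_subtractf ind[OF fin] PE n \<alpha>_def)
  have nb: "(\<Sum>u | (v, u) \<in> parcs H. f u)
      = real (card {u \<in> E. (v, u) \<in> parcs H}) - real d / real n * real (card E)"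
    if v: "v \<in> pverts H" for v
  proof -
    have "finite {u. (v, u) \<in> parcs H}"
      by (rule finite_subset[OF _ fin]) (use ndl_graph_wf[OF H] in blast)
    moreover have "{u. (v, u) \<in> parcs H} \<inter> E = {u \<in> E. (v, u) \<in> parcs H}" by auto
    ultimately show ?thesis
      by (simp add: f_def sum_subtractf ind ndl_graph_degree[OF H v] \<alpha>_def)
  qed
  have "(\<Sum>v\<in>pverts H. (f v)\<^sup>2)
      = (\<Sum>v\<in>pverts H. of_bool (v \<in> E) - 2 * \<alpha> * of_bool (v \<in> E) + \<alpha>\<^sup>2)"
    by (intro sum.cong) (auto simp: f_def power2_eq_square algebra_simps)
  also have "\<dots> = card E - 2 * \<alpha> * card E + n * \<alpha>\<^sup>2"
    by (simp add: sum.distrib sum_subtractf ind[OF fin] PE n flip: sum_distrib_left)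
  also have "n * \<alpha>\<^sup>2 = \<alpha> * card E" using False by (simp add: \<alpha>_def power2_eq_square)
  \<comment> \<open>The exact value is \<open>card E - \<alpha> * card E\<close>; the subtracted
    term is dropped.\<close>
  finally have "(\<Sum>v\<in>pverts H. (f v)\<^sup>2) \<le> card E" by (simp add: \<alpha>_def)
  have "(\<Sum>v\<in>E. (real (card {u \<in> E. (v, u) \<in> parcs H}) - real d / real n * real (card E))\<^sup>2)
      = (\<Sum>v\<in>E. (\<Sum>u | (v, u) \<in> parcs H. f u)\<^sup>2)"
    using nb E by (intro sum.cong) (auto simp: subset_iff)
  \<comment> \<open>Extending the sum from \<open>E\<close> to all vertices only adds
    squares.\<close>
  also have "\<dots> \<le> (\<Sum>v\<in>pverts H. (\<Sum>u | (v, u) \<in> parcs H. f u)\<^sup>2)"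
    using E fin by (intro sum_mono2) auto
  also have "\<dots> \<le> lam\<^sup>2 * (\<Sum>v\<in>pverts H. (f v)\<^sup>2)"
    by (rule ndl_graph_norm_sq_le[OF H f0])
  also have "\<dots> \<le> lam\<^sup>2 * card E"
    using \<open>(\<Sum>v\<in>pverts H. (f v)\<^sup>2) \<le> card E\<close> by (intro mult_left_mono) auto
  finally show ?thesis .
qed

section \<open>Counting two-coloured walks\<close>

lemma abs_sum_le_of_sum_sq_le:
  fixes p :: "'a \<Rightarrow> real" and c :: real
  assumes "(\<Sum>v\<in>E. (p v)\<^sup>2) \<le> c\<^sup>2 * card E"
  shows "\<bar>\<Sum>v\<in>E. p v\<bar> \<le> \<bar>c\<bar> * card E"
proof -
  \<comment> \<open>Cauchy-Schwarz against the constant function 1.\<close>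
  have "(\<Sum>v\<in>E. p v)\<^sup>2 \<le> (\<Sum>v\<in>E. (p v)\<^sup>2) * card E"
    using Cauchy_Schwarz_ineq_sum[of p "\<lambda>_. 1" E] by simp
  also have "\<dots> \<le> (c * card E)\<^sup>2"
    using mult_right_mono[OF assms, of "card E"] by (simp add: power2_eq_square mult_ac)
  finally show ?thesis by (simp add: abs_le_square_iff[symmetric] abs_mult)
qed

text \<open>Group the triples by their middle vertex \<open>v\<close>. Symmetry turns both ends into
  neighbours of \<open>v\<close>, and since \<open>u = w\<close> is allowed, the two choices are
  independent.\<close>

lemma e_col_eq_sum:
  assumes sym: "\<And>u v. (u, v) \<in> parcs G \<Longrightarrow> (v, u) \<in> parcs G" and fin: "finite E"
  shows "e_col G c r b E = (\<Sum>v\<in>E. card {u \<in> E. (v, u) \<in> parcs (color_class G c r)}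
    * card {u \<in> E. (v, u) \<in> parcs (color_class G c b)})"
proof -
  let ?N = "\<lambda>i v. {u \<in> E. (v, u) \<in> parcs (color_class G c i)}"
  let ?T = "SIGMA v:E. ?N r v \<times> ?N b v"
  have "{(u, v, w). (u, v, w) \<in> E \<times> E \<times> E \<and> (u, v) \<in> parcs G \<and> (v, w) \<in> parcs G
      \<and> c {u, v} = r \<and> c {v, w} = b} = (\<lambda>(v, u, w). (u, v, w)) ` ?T"
    using sym by (auto simp: color_class_def insert_commute image_iff)
  moreover have "inj_on (\<lambda>(v, u, w). (u, v, w)) ?T" by (auto simp: inj_on_def)
  ultimately have "e_col G c r b E = card ?T" by (simp add: e_col_def card_image)
  then show ?thesis using fin by (simp add: card_cartesian_product)
qed

theorem theorem5:
  fixes G :: "'a pair_pre_digraph" and c :: "'a set \<Rightarrow> nat"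
    and n d t r b :: nat and lam :: real and E :: "'a set"
  assumes "rc_graph n d lam t G c"
    and "r \<in> {1..t}" and "b \<in> {1..t}"
    and "E \<subseteq> pverts G"
  shows "\<bar>real (e_col G c r b E) - (real d / real n)\<^sup>2 * real (card E) ^ 3\<bar>
    \<le> 2 * (lam * real d / real n) * (real (card E))\<^sup>2 + lam\<^sup>2 * real (card E)"
proof -
  have ndl: "ndl_graph n d lam (color_class G c r)" "ndl_graph n d lam (color_class G c b)"
    using assms(1-3) by (auto simp: rc_graph_def)
  interpret pair_graph G using assms(1) by (simp add: rc_graph_def)
  have sym: "(v, u) \<in> parcs G" if "(u, v) \<in> parcs G" for u v
    using that pair_sym_arcs by (auto simp: symmetric_def sym_def)
  have fin: "finite E" using assms(4) pair_finite_verts by (rule finite_subset)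
  have E: "E \<subseteq> pverts (color_class G c i)" for i using assms(4) by (simp add: color_class_def)
  define k where "k = real d / real n * real (card E)"
  define p where "p i v = real (card {u \<in> E. (v, u) \<in> parcs (color_class G c i)}) - k" for i v
  let ?m = "real (card E)"
  have sq: "(\<Sum>v\<in>E. (p r v)\<^sup>2) \<le> lam\<^sup>2 * ?m" "(\<Sum>v\<in>E. (p b v)\<^sup>2) \<le> lam\<^sup>2 * ?m"
    unfolding p_def k_def by (rule ndl_graph_degree_deviation[OF ndl(1) E],
      rule ndl_graph_degree_deviation[OF ndl(2) E])
  \<comment> \<open>Cauchy-Schwarz couples the two colours through their separate deviation
    bounds.\<close>
  have "(\<Sum>v\<in>E. p r v * p b v)\<^sup>2 \<le> (lam\<^sup>2 * ?m) * (lam\<^sup>2 * ?m)"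
    by (rule order_trans[OF Cauchy_Schwarz_ineq_sum]) (intro mult_mono sq, auto simp: sum_nonneg)
  then have "(\<Sum>v\<in>E. p r v * p b v)\<^sup>2 \<le> (lam\<^sup>2 * ?m)\<^sup>2" by (simp add: power2_eq_square)
  then have prod: "\<bar>\<Sum>v\<in>E. p r v * p b v\<bar> \<le> lam\<^sup>2 * ?m"
    by (simp add: abs_le_square_iff[symmetric])
  \<comment> \<open>The deviation bounds control only \<open>\<bar>lam\<bar>\<close>, while the
    claim has \<open>lam\<close>. If \<open>d\<close> and \<open>n\<close> are positive,
    \<open>lam\<close> is nonnegative; otherwise \<open>k = 0\<close>, using that division by zero
    yields zero.\<close>
  have k: "k * \<bar>lam\<bar> = k * lam"
  proof (cases "d = 0 \<or> n = 0")
    case False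
    then show ?thesis using ndl_graph_lam_nonneg[OF ndl(1)] by simp
  qed (auto simp: k_def)
  have lin: "\<bar>k * (\<Sum>v\<in>E. p i v)\<bar> \<le> k * lam * ?m" if "(\<Sum>v\<in>E. (p i v)\<^sup>2) \<le> lam\<^sup>2 * ?m" for i
  proof -
    have "\<bar>k * (\<Sum>v\<in>E. p i v)\<bar> = k * \<bar>\<Sum>v\<in>E. p i v\<bar>" by (simp add: abs_mult k_def)
    also have "\<dots> \<le> k * (\<bar>lam\<bar> * ?m)"
      by (rule mult_left_mono[OF abs_sum_le_of_sum_sq_le[OF that]]) (simp add: k_def)
    finally show ?thesis by (metis k mult.assoc)
  qed
  \<comment> \<open>Expanding around \<open>k\<close>, the constant term is the main term, the two
    linear terms give the error quadratic in \<open>card E\<close>, and the product of deviations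
    gives the error linear in it.\<close>
  have "real (e_col G c r b E) = (\<Sum>v\<in>E. (p r v + k) * (p b v + k))"
    by (simp add: e_col_eq_sum[OF sym fin] p_def)
  also have "\<dots> = (\<Sum>v\<in>E. p r v * p b v) + k * (\<Sum>v\<in>E. p r v) + k * (\<Sum>v\<in>E. p b v) + k\<^sup>2 * ?m"
    by (simp add: algebra_simps sum.distrib sum_distrib_left power2_eq_square)
  also have "k\<^sup>2 * ?m = (real d / real n)\<^sup>2 * ?m ^ 3"
    by (simp add: k_def power2_eq_square power3_eq_cube)
  finally have "\<bar>real (e_col G c r b E) - (real d / real n)\<^sup>2 * ?m ^ 3\<bar>
      \<le> lam\<^sup>2 * ?m + k * lam * ?m + k * lam * ?m"
    using prod lin[OF sq(1)] lin[OF sq(2)] by linarith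
  also have "k * lam * ?m = (lam * real d / real n) * ?m\<^sup>2"
    by (simp add: k_def power2_eq_square)
  finally show ?thesis by simp
qed

end
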